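(* Let $X$ be a $T_0$ space. Then $\mathcal{D}_c(X)\subseteq \mathsf{RD}(X)\subseteq \mathsf{WD}(X)\subseteq \mathsf{Irr}_c(X)$.
   Context: For a $T_0$ space $X$, the specialization order is $x\le y$ iff $x\in\overline{\{y\}}$; order notions refer to it. A directed subset of $X$ is a nonempty subset in which any two elements have an upper bound in the subset; $\mathcal D_c(X)$ is the set of closures $\overline{D}$ of directed subsets $D$ of $X$. A nonempty subset $A$ is irreducible if whenever $A\subseteq F_1\cup F_2$ with $F_1,F_2$ closed, then $A\subseteq F_1$ or $A\subseteq F_2$; $\mathsf{Irr}_c(X)$ is the set of irreducible closed subsets. $\mathsf{K}(X)$ is the set of nonempty compact saturated subsets (saturated = upper set in the specialization order). A family $\mathcal K\subseteq \mathsf K(X)$ is filtered if it is nonempty and for all $K_1,K_2\in\mathcal K$ there is $K_3\in\mathcal K$ with $K_3\subseteq K_1\cap K_2$. $\mathsf{RD}(X)$ is the set of Rudin sets: nonempty closed subsets $A$ for which there is a filtered family $\mathcal K\subseteq\mathsf K(X)$ such that $A$ is minimal (under inclusion) among the closed subsets of $X$ that meet every member of $\mathcal K$. A space $Y$ is well-filtered if it is $T_0$ and for every open $U\subseteq Y$ and every filtered family $\mathcal K\subseteq\mathsf K(Y)$, $\bigcap\mathcal K\subseteq U$ implies $K\subseteq U$ for some $K\in\mathcal K$. $\mathsf{WD}(X)$ is the set of closed subsets $A$ of $X$ such that for every continuous map $f:X\to Y$ to a well-filtered space $Y$ there is a unique $y_A\in Y$ with $\overline{f(A)}=\overline{\{y_A\}}$.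 *)

theory Defs
  imports "HOL-Analysis.Analysis"
begin

definition spec_le :: "'a topology \<Rightarrow> 'a \<Rightarrow> 'a \<Rightarrow> bool" where
  "spec_le X x y \<longleftrightarrow> x \<in> topspace X \<and> y \<in> topspace X \<and> x \<in> X closure_of {y}"

definition directed_in :: "'a topology \<Rightarrow> 'a set \<Rightarrow> bool" where
  "directed_in X D \<longleftrightarrow> D \<subseteq> topspace X \<and> D \<noteq> {} \<and>
     (\<forall>x\<in>D. \<forall>y\<in>D. \<exists>z\<in>D. spec_le X x z \<and> spec_le X y z)"

definition Dc :: "'a topology \<Rightarrow> 'a set set" where
  "Dc X = {X closure_of D | D. directed_in X D}"

definition irreducible_in :: "'a topology \<Rightarrow> 'a set \<Rightarrow> bool" where
  "irreducible_in X A \<longleftrightarrow> A \<subseteq> topspace X \<and> A \<noteq> {} \<and>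
     (\<forall>F1 F2. closedin X F1 \<and> closedin X F2 \<and> A \<subseteq> F1 \<union> F2 \<longrightarrow> A \<subseteq> F1 \<or> A \<subseteq> F2)"

definition Irrc :: "'a topology \<Rightarrow> 'a set set" where
  "Irrc X = {A. closedin X A \<and> irreducible_in X A}"

definition saturated_in :: "'a topology \<Rightarrow> 'a set \<Rightarrow> bool" where
  "saturated_in X K \<longleftrightarrow> K \<subseteq> topspace X \<and> (\<forall>x\<in>K. \<forall>y. spec_le X x y \<longrightarrow> y \<in> K)"

definition KK :: "'a topology \<Rightarrow> 'a set set" where
  "KK X = {K. K \<noteq> {} \<and> compactin X K \<and> saturated_in X K}"

definition filtered :: "'a set set \<Rightarrow> bool" where
  "filtered \<K> \<longleftrightarrow> \<K> \<noteq> {} \<and> (\<forall>K1\<in>\<K>. \<forall>K2\<in>\<K>. \<exists>K3\<in>\<K>. K3 \<subseteq> K1 \<inter> K2)"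

definition closed_meeting :: "'a topology \<Rightarrow> 'a set set \<Rightarrow> 'a set set" where
  "closed_meeting X \<K> = {B. closedin X B \<and> (\<forall>K\<in>\<K>. B \<inter> K \<noteq> {})}"

definition RD :: "'a topology \<Rightarrow> 'a set set" where
  "RD X = {A. A \<noteq> {} \<and> closedin X A \<and>
     (\<exists>\<K>. \<K> \<subseteq> KK X \<and> filtered \<K> \<and> A \<in> closed_meeting X \<K> \<and>
        (\<forall>B\<in>closed_meeting X \<K>. B \<subseteq> A \<longrightarrow> B = A))}"

definition well_filtered :: "'a topology \<Rightarrow> bool" where
  "well_filtered Y \<longleftrightarrow> t0_space Y \<and>
     (\<forall>U \<K>. openin Y U \<and> \<K> \<subseteq> KK Y \<and> filtered \<K> \<and> \<Inter>\<K> \<subseteq> U \<longrightarrow> (\<exists>K\<in>\<K>. K \<subseteq> U))"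

text \<open>
  The definition of \<open>WD(X)\<close> ranges over well-filtered spaces of arbitrary size, but a HOL definition
  cannot quantify over types. \<open>WD_via TYPE('b) X\<close> is the version whose test spaces live on
  the type \<open>'b\<close>, and \<open>WD X\<close> uses test spaces on \<open>'a set\<close>. The lemma \<open>WD_subset_WD_via\<close> below
  shows that nothing is lost: members of \<open>WD X\<close> have the defining property for well-filtered
  spaces on every type, so \<open>WD X\<close> is the intersection of the sets \<open>WD_via TYPE('b) X\<close> over all
  types \<open>'b\<close>.
\<close>

definition WD_via :: "'b itself \<Rightarrow> 'a topology \<Rightarrow> 'a set set" where
  "WD_via (_ :: 'b itself) X = {A. closedin X A \<and>
     (\<forall>(Y :: 'b topology) f. well_filtered Y \<and> continuous_map X Y f \<longrightarrow>
        (\<exists>!y. y \<in> topspace Y \<and> Y closure_of (f ` A) = Y closure_of {y}))}"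

definition WD :: "'a topology \<Rightarrow> 'a set set" where
  "WD X = WD_via TYPE('a set) X"

lemma openin_maximal_not_covering:
  assumes comp: "\<And>K. K \<in> \<K> \<Longrightarrow> compactin Y K"
    and U: "openin Y U" "\<And>K. K \<in> \<K> \<Longrightarrow> \<not> K \<subseteq> U"
  shows "\<exists>M. openin Y M \<and> U \<subseteq> M \<and> (\<forall>K\<in>\<K>. \<not> K \<subseteq> M) \<and>
    (\<forall>N. openin Y N \<and> M \<subseteq> N \<and> (\<forall>K\<in>\<K>. \<not> K \<subseteq> N) \<longrightarrow> N = M)"
proof -
  define \<A> where "\<A> = {V. openin Y V \<and> U \<subseteq> V \<and> (\<forall>K\<in>\<K>. \<not> K \<subseteq> V)}"
  have "\<exists>M\<in>\<A>. \<forall>N\<in>\<A>. M \<subseteq> N \<longrightarrow> N = M"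
  proof (rule subset_Zorn_nonempty)
    show "\<A> \<noteq> {}" using U unfolding \<A>_def by blast
    fix \<C> assume ne: "\<C> \<noteq> {}" and ch: "subset.chain \<A> \<C>"
    have sub: "\<C> \<subseteq> \<A>" using ch by (simp add: subset_chain_def)
    have "\<not> K \<subseteq> \<Union>\<C>" if K: "K \<in> \<K>" for K
    proof
      assume "K \<subseteq> \<Union>\<C>"
      moreover have "\<forall>V\<in>\<C>. openin Y V" using sub unfolding \<A>_def by blast
      ultimately obtain \<F> where F: "finite \<F>" "\<F> \<subseteq> \<C>" "K \<subseteq> \<Union>\<F>"
        using comp[OF K] unfolding compactin_def by meson
      have "\<exists>V\<in>\<C>. K \<subseteq> V"
      proof (cases "\<F> = {}")
        case True
        then show ?thesis using F ne by blast
      next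
        case False
        then have "\<Union>\<F> \<in> \<F>"
          using F ch
          by (intro Union_in_chain[of _ \<A>]) (auto simp: subset_chain_def, blast)
        then show ?thesis using F by blast
      qed
      then show False using sub K unfolding \<A>_def by blast
    qed
    moreover have "openin Y (\<Union>\<C>)" using sub unfolding \<A>_def by blast
    moreover have "U \<subseteq> \<Union>\<C>" using sub ne unfolding \<A>_def by blast
    ultimately show "\<Union>\<C> \<in> \<A>" unfolding \<A>_def by blast
  qed
  then obtain M where M: "M \<in> \<A>" "\<forall>N\<in>\<A>. M \<subseteq> N \<longrightarrow> N = M" by blast
  have "N = M" if "openin Y N" "M \<subseteq> N" "\<forall>K\<in>\<K>. \<not> K \<subseteq> N" for N
  proof -
    have "N \<in> \<A>" using that M(1) by (auto simp: \<A>_def)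
    then show ?thesis using M(2) that(2) by blast
  qed
  then show ?thesis using M(1) by (intro exI[of _ M]) (simp add: \<A>_def)
qed

lemma closure_of_pullback:
  assumes "h ` A \<subseteq> topspace Y" "S \<subseteq> A" "a \<in> A"
  shows "a \<in> pullback_topology A h Y closure_of S \<longleftrightarrow> h a \<in> Y closure_of (h ` S)"
proof -
  have ha: "h a \<in> topspace Y" "a \<in> topspace (pullback_topology A h Y)"
    using assms unfolding topspace_pullback_topology by blast+
  have "(\<forall>T. a \<in> T \<and> openin (pullback_topology A h Y) T \<longrightarrow> (\<exists>y. y \<in> S \<and> y \<in> T)) \<longleftrightarrow>
    (\<forall>V. openin Y V \<longrightarrow> a \<in> h -` V \<inter> A \<longrightarrow> (\<exists>y. y \<in> S \<and> y \<in> h -` V \<inter> A))"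
    unfolding openin_pullback_topology by metis
  also have "\<dots> \<longleftrightarrow> (\<forall>V. h a \<in> V \<and> openin Y V \<longrightarrow> (\<exists>y. y \<in> h ` S \<and> y \<in> V))"
    using assms(2,3) by (simp add: subset_eq) blast
  finally show ?thesis
    using ha by (simp add: in_closure_of)
qed

lemma upset_in_KK:
  assumes K: "compactin Y K" "K \<noteq> {}"
  shows "{y. \<exists>x\<in>K. spec_le Y x y} \<in> KK Y"
proof -
  let ?S = "{y. \<exists>x\<in>K. spec_le Y x y}"
  have Kt: "K \<subseteq> topspace Y" using K by (simp add: compactin_def)
  have KS: "K \<subseteq> ?S" using Kt unfolding spec_le_def in_closure_of by blast
  have up: "\<And>V. openin Y V \<Longrightarrow> K \<subseteq> V \<Longrightarrow> ?S \<subseteq> V"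
    unfolding spec_le_def in_closure_of by blast
  have "compactin Y ?S"
    unfolding compactin_def
  proof (intro conjI allI impI)
    show "?S \<subseteq> topspace Y" unfolding spec_le_def by blast
    fix \<U> assume U: "(\<forall>U\<in>\<U>. openin Y U) \<and> ?S \<subseteq> \<Union>\<U>"
    then have "K \<subseteq> \<Union>\<U>" using KS by blast
    then obtain \<F> where F: "finite \<F>" "\<F> \<subseteq> \<U>" "K \<subseteq> \<Union>\<F>"
      using K U unfolding compactin_def by meson
    then have "openin Y (\<Union>\<F>)" using U by blast
    then show "\<exists>\<F>. finite \<F> \<and> \<F> \<subseteq> \<U> \<and> ?S \<subseteq> \<Union>\<F>" using up F by meson
  qed
  moreover have "saturated_in Y ?S"
    unfolding saturated_in_def
  proof (intro conjI ballI allI impI)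
    show "?S \<subseteq> topspace Y" unfolding spec_le_def by blast
    fix y z assume "y \<in> ?S" and z: "spec_le Y y z"
    then obtain x where x: "x \<in> K" "spec_le Y x y" by blast
    have "Y closure_of {y} \<subseteq> Y closure_of {z}"
      by (rule closure_of_minimal) (use z in \<open>auto simp: spec_le_def\<close>)
    then have "spec_le Y x z" using x z unfolding spec_le_def by blast
    then show "z \<in> ?S" using x by blast
  qed
  moreover have "?S \<noteq> {}" using KS K by blast
  ultimately show ?thesis unfolding KK_def by blast
qed

lemma well_filtered_pullback:
  assumes Y: "well_filtered Y" and inj: "inj_on h A" and hA: "h ` A \<subseteq> topspace Y"
    and bcl: "\<And>z. \<lbrakk>z \<in> topspace Y; z \<in> Y closure_of (Y closure_of {z} \<inter> h ` A)\<rbrakk> \<Longrightarrow> z \<in> h ` A"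
  shows "well_filtered (pullback_topology A h Y)" (is "well_filtered ?Z")
proof -
  have tZ: "topspace ?Z = A" using hA unfolding topspace_pullback_topology by blast
  have cl: "a \<in> ?Z closure_of {b} \<longleftrightarrow> h a \<in> Y closure_of {h b}" if "a \<in> A" "b \<in> A" for a b
    using closure_of_pullback[OF hA, of "{b}" a] that by simp
  have t0: "t0_space ?Z"
    unfolding t0_space_def tZ
  proof (intro ballI impI)
    fix a b assume ab: "a \<in> A" "b \<in> A" "a \<noteq> b"
    then have "h a \<noteq> h b" "h a \<in> topspace Y" "h b \<in> topspace Y"
      using inj hA by (auto simp: inj_on_def)
    then obtain V where "openin Y V" "h a \<notin> V \<longleftrightarrow> h b \<in> V"
      using Y unfolding well_filtered_def t0_space_def by metis
    then show "\<exists>V. openin ?Z V \<and> (a \<notin> V) = (b \<in> V)"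
      using ab unfolding openin_pullback_topology
      by (intro exI[of _ "h -` V \<inter> A"]) auto
  qed
  have "\<exists>K\<in>\<K>. K \<subseteq> W"
    if W: "openin ?Z W" and K: "\<K> \<subseteq> KK ?Z" "filtered \<K>" and sub: "\<Inter>\<K> \<subseteq> W" for W \<K>
  proof (rule ccontr)
    assume neg: "\<not> (\<exists>K\<in>\<K>. K \<subseteq> W)"
    obtain U where U: "openin Y U" "W = h -` U \<inter> A"
      using W unfolding openin_pullback_topology by blast
    have KA: "K \<subseteq> A" if "K \<in> \<K>" for K
      using K that tZ unfolding KK_def compactin_def by blast
    have cont: "continuous_map ?Z Y h"
      using continuous_map_pullback[OF continuous_map_id, of A h Y] by simp
    have comp: "compactin Y (h ` K)" if "K \<in> \<K>" for K
      using K that cont unfolding KK_def by (blast intro: image_compactin)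
    have c1: "compactin Y L" if "L \<in> (`) h ` \<K>" for L using comp that by blast
    have c2: "\<not> L \<subseteq> U" if "L \<in> (`) h ` \<K>" for L using that neg U KA by blast
    have "\<exists>M. openin Y M \<and> U \<subseteq> M \<and> (\<forall>L\<in>(`) h ` \<K>. \<not> L \<subseteq> M) \<and>
      (\<forall>N. openin Y N \<and> M \<subseteq> N \<and> (\<forall>L\<in>(`) h ` \<K>. \<not> L \<subseteq> N) \<longrightarrow> N = M)"
      by (rule openin_maximal_not_covering) (fact c1 U(1) c2)+
    then obtain M where M: "openin Y M" "U \<subseteq> M" "\<forall>L\<in>(`) h ` \<K>. \<not> L \<subseteq> M"
      and maxM: "\<forall>N. openin Y N \<and> M \<subseteq> N \<and> (\<forall>L\<in>(`) h ` \<K>. \<not> L \<subseteq> N) \<longrightarrow> N = M"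
      by (elim exE conjE)
    have max: "N = M" if "openin Y N" "M \<subseteq> N" "\<And>L. L \<in> (`) h ` \<K> \<Longrightarrow> \<not> L \<subseteq> N" for N
      using maxM that by blast
    define up where "up K = {y. \<exists>x\<in>h ` K. spec_le Y x y}" for K
    have hKup: "h ` K \<subseteq> up K" if "K \<in> \<K>" for K
      using KA[OF that] hA unfolding up_def spec_le_def in_closure_of by blast
    have upKK: "up ` \<K> \<subseteq> KK Y"
    proof
      fix P assume "P \<in> up ` \<K>"
      then obtain K where "K \<in> \<K>" "P = up K" by blast
      moreover from this have "h ` K \<noteq> {}" using K unfolding KK_def by blast
      ultimately show "P \<in> KK Y" using upset_in_KK comp unfolding up_def by metis
    qed
    have mono: "K \<subseteq> L \<Longrightarrow> up K \<subseteq> up L" for K L unfolding up_def by blast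
    have fil: "filtered (up ` \<K>)"
      unfolding filtered_def
    proof (intro conjI ballI)
      show "up ` \<K> \<noteq> {}" using K unfolding filtered_def by blast
      fix P Q assume "P \<in> up ` \<K>" "Q \<in> up ` \<K>"
      then obtain K1 K2 where 12: "K1 \<in> \<K>" "K2 \<in> \<K>" "P = up K1" "Q = up K2" by blast
      then obtain K3 where "K3 \<in> \<K>" "K3 \<subseteq> K1 \<inter> K2" using K unfolding filtered_def by blast
      then show "\<exists>R\<in>up ` \<K>. R \<subseteq> P \<inter> Q" using mono 12 by (metis Int_subset_iff imageI)
    qed
    have "\<not> \<Inter>(up ` \<K>) \<subseteq> M"
    proof
      assume "\<Inter>(up ` \<K>) \<subseteq> M"
      then obtain K where "K \<in> \<K>" "up K \<subseteq> M"
        using Y M(1) upKK fil unfolding well_filtered_def by blast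
      then show False using M(3) hKup by blast
    qed
    then obtain z where z: "z \<notin> M" "\<And>K. K \<in> \<K> \<Longrightarrow> z \<in> up K" by blast
    have zx: "\<exists>x\<in>h ` K. x \<in> Y closure_of {z}" if "K \<in> \<K>" for K
      using z(2)[OF that] unfolding up_def spec_le_def by blast
    obtain K0 where "K0 \<in> \<K>" using K unfolding filtered_def by blast
    then have zt: "z \<in> topspace Y" using z(2) unfolding up_def spec_le_def by blast
    let ?C = "Y closure_of {z}" let ?D = "Y closure_of (?C \<inter> h ` A)"
    have DC: "?D \<subseteq> ?C" by (simp add: closure_of_minimal)
    have "M \<inter> ?C = {}" using z(1) M(1) unfolding in_closure_of disjoint_iff by blast
    then have MC: "M \<subseteq> topspace Y - ?C" using openin_subset[OF M(1)] by blast
    have CM: "topspace Y - ?C = M"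
    proof (rule max)
      fix L assume "L \<in> (`) h ` \<K>"
      then show "\<not> L \<subseteq> topspace Y - ?C" using zx by blast
    qed (use MC in auto)
    have DM: "topspace Y - ?D = M"
    proof (rule max)
      fix L assume "L \<in> (`) h ` \<K>"
      then obtain K where L: "K \<in> \<K>" "L = h ` K" by blast
      then obtain x where x: "x \<in> L" "x \<in> ?C" using zx by blast
      then have "x \<in> ?C \<inter> h ` A" using KA L by blast
      moreover have "?C \<inter> h ` A \<subseteq> ?D"
        by (intro closure_of_subset) (use hA in blast)
      ultimately show "\<not> L \<subseteq> topspace Y - ?D" using x by blast
    qed (use MC DC in auto)
    have "z \<in> ?D" using DM z(1) zt by blast
    then obtain a where a: "a \<in> A" "z = h a" using bcl[OF zt] by blast
    have "a \<in> K" if inK: "K \<in> \<K>" for K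
    proof -
      obtain k where k: "k \<in> K" "h k \<in> Y closure_of {h a}" using zx[OF inK] a by blast
      then have "spec_le ?Z k a" using KA[OF inK] a cl unfolding spec_le_def tZ by blast
      then show ?thesis using k inK K unfolding KK_def saturated_in_def by blast
    qed
    then have "a \<in> W" using sub by blast
    then show False using U M(2) z(1) a by blast
  qed
  then show ?thesis using t0 unfolding well_filtered_def by blast
qed

lemma WD_subset_WD_via: "WD X \<subseteq> WD_via TYPE('b) X"
proof
  fix A assume A: "A \<in> WD X"
  have clA: "closedin X A" using A unfolding WD_def WD_via_def by blast
  have At: "A \<subseteq> topspace X" using clA closedin_subset by blast
  have "\<exists>!y. y \<in> topspace Y \<and> Y closure_of (f ` A) = Y closure_of {y}"
    if Y: "well_filtered Y" and f: "continuous_map X Y f" for Y :: "'b topology" and f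
  proof -
    define Y' where "Y' = {y \<in> topspace Y. y \<in> Y closure_of (Y closure_of {y} \<inter> f ` topspace X)}"
    define g where "g y = {x \<in> topspace X. f x \<in> Y closure_of {y}}" for y
    define B where "B = g ` Y'"
    define h where "h = inv_into Y' g"
    let ?Z = "pullback_topology B h Y"
    have t0: "x = y" if "x \<in> topspace Y" "y \<in> topspace Y" "Y closure_of {x} = Y closure_of {y}" for x y
      using Y that unfolding well_filtered_def t0_space_closure_of_sing by blast
    have clg: "Y closure_of {y} = Y closure_of (f ` g y)" if "y \<in> Y'" for y
    proof
      have e: "Y closure_of {y} \<inter> f ` topspace X = f ` g y" unfolding g_def by blast
      show "Y closure_of {y} \<subseteq> Y closure_of (f ` g y)"
        by (rule closure_of_minimal) (use that e in \<open>auto simp: Y'_def\<close>)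
      show "Y closure_of (f ` g y) \<subseteq> Y closure_of {y}"
        by (rule closure_of_minimal) (auto simp: g_def)
    qed
    have injg: "inj_on g Y'"
    proof (rule inj_onI)
      fix x y assume "x \<in> Y'" "y \<in> Y'" "g x = g y"
      then show "x = y" using clg t0 by (metis (no_types, lifting) Y'_def mem_Collect_eq)
    qed
    have hg: "h (g y) = y" if "y \<in> Y'" for y using injg that by (simp add: h_def)
    have hB: "h ` B = Y'" using hg unfolding B_def image_image by simp
    have injh: "inj_on h B" unfolding h_def B_def by (rule inj_on_inv_into) simp
    have hBt: "h ` B \<subseteq> topspace Y" unfolding hB Y'_def by blast
    have fY': "f x \<in> Y'" if "x \<in> topspace X" for x
    proof -
      have fx: "f x \<in> topspace Y" using f that by (auto simp: continuous_map_def)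
      then have "f x \<in> Y closure_of {f x}" unfolding in_closure_of by blast
      then have "f x \<in> Y closure_of {f x} \<inter> f ` topspace X" using that by blast
      then have "f x \<in> Y closure_of (Y closure_of {f x} \<inter> f ` topspace X)"
        using fx unfolding in_closure_of[of _ _ "_ \<inter> _"] by blast
      then show ?thesis using fx unfolding Y'_def by blast
    qed
    have "well_filtered ?Z"
    proof (rule well_filtered_pullback[OF Y injh hBt])
      fix z assume z: "z \<in> topspace Y" "z \<in> Y closure_of (Y closure_of {z} \<inter> h ` B)"
      have "z \<in> Y closure_of (Y closure_of {z} \<inter> f ` topspace X)"
        unfolding in_closure_of[of z]
      proof (intro conjI allI impI)
        show "z \<in> topspace Y" by (rule z)
        fix V assume V: "z \<in> V \<and> openin Y V"
        then obtain y where y: "y \<in> V" "y \<in> Y closure_of {z}" "y \<in> Y'"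
          using z(2) unfolding hB in_closure_of[of z] by blast
        then obtain w where w: "w \<in> V" "w \<in> Y closure_of {y}" "w \<in> f ` topspace X"
        proof -
          have "y \<in> Y closure_of (Y closure_of {y} \<inter> f ` topspace X)"
            using y(3) unfolding Y'_def by blast
          then show thesis
            using that V y(1) unfolding in_closure_of[of y Y "_ \<inter> _"] by blast
        qed
        have "Y closure_of {y} \<subseteq> Y closure_of {z}"
          by (rule closure_of_minimal) (use y in auto)
        then show "\<exists>y. y \<in> Y closure_of {z} \<inter> f ` topspace X \<and> y \<in> V" using w by blast
      qed
      then show "z \<in> h ` B" unfolding hB Y'_def using z by blast
    qed
    moreover have "continuous_map X ?Z (g \<circ> f)"
    proof (rule continuous_map_pullback')
      show "continuous_map X Y (h \<circ> (g \<circ> f))"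
        by (rule continuous_map_eq[OF f]) (simp add: hg fY')
      show "topspace X \<subseteq> (g \<circ> f) -` B" unfolding B_def using fY' by auto
    qed
    ultimately obtain b where b: "b \<in> topspace ?Z"
      "?Z closure_of ((g \<circ> f) ` A) = ?Z closure_of {b}"
      using A unfolding WD_def WD_via_def by blast
    have bB: "b \<in> B" using b(1) unfolding topspace_pullback_topology by blast
    have hb: "h b \<in> topspace Y" using bB hBt by blast
    have gfA: "(g \<circ> f) ` A \<subseteq> B" unfolding B_def using fY' At by auto
    have hgfA: "h ` (g \<circ> f) ` A = f ` A" using hg fY' At by (force simp: image_iff)
    have "b \<in> ?Z closure_of {b}" using b(1) unfolding in_closure_of by blast
    then have "h b \<in> Y closure_of (f ` A)"
      using closure_of_pullback[OF hBt gfA bB] b(2) hgfA by simp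
    then have 1: "Y closure_of {h b} \<subseteq> Y closure_of (f ` A)"
      by (intro closure_of_minimal) auto
    have "f x \<in> Y closure_of {h b}" if "x \<in> A" for x
    proof -
      have xB: "g (f x) \<in> B" using gfA that by auto
      have "(g \<circ> f) ` A \<subseteq> topspace ?Z"
        using gfA hBt unfolding topspace_pullback_topology by blast
      then have "g (f x) \<in> ?Z closure_of ((g \<circ> f) ` A)"
        using closure_of_subset that by fastforce
      then have "h (g (f x)) \<in> Y closure_of {h b}"
        using closure_of_pullback[OF hBt _ xB, of "{b}"] bB b(2) by simp
      then show ?thesis using hg fY' At that by auto
    qed
    then have "Y closure_of (f ` A) \<subseteq> Y closure_of {h b}"
      by (intro closure_of_minimal) auto
    then have "Y closure_of (f ` A) = Y closure_of {h b}" using 1 by blast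
    then show ?thesis using hb t0 by metis
  qed
  then show "A \<in> WD_via TYPE('b) X" using clA unfolding WD_via_def by blast
qed

end

theory Submission
  imports Defs
begin

text \<open>
  If \<open>D\<close> is directed, the principal upper sets of its elements form a filtered family that has
  the closure of \<open>D\<close> as a minimal closed transversal. If \<open>A\<close> is minimal for \<open>\<K>\<close> and \<open>f\<close> maps \<open>X\<close> into
  a well-filtered space, the upper sets of \<open>f ` (A \<inter> K)\<close> have a common point \<open>y\<close> in the closure of
  \<open>f ` A\<close>, and minimality applied to \<open>{x \<in> A. f x \<le> y}\<close> gives \<open>f ` A \<le> y\<close>. If \<open>A\<close> is covered by
  closed sets \<open>F1\<close>, \<open>F2\<close> but by neither alone, the map to the square of the Sierpinski space (a finite
  \<open>T\<^sub>0\<close> space, hence well-filtered) given by the complements of \<open>F1\<close> and \<open>F2\<close> sends \<open>A\<close> to a set with two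
  incomparable elements whose closure misses their only upper bound.
\<close>

lemma spec_le_refl: "x \<in> topspace X \<Longrightarrow> spec_le X x x"
  unfolding spec_le_def in_closure_of by blast

lemma closedin_spec_le:
  assumes "closedin X B" "spec_le X x y" "y \<in> B"
  shows "x \<in> B"
  using closure_of_minimal[of "{y}" B X] assms unfolding spec_le_def by blast

lemma filteredI_image:
  assumes "\<K> \<noteq> {}"
    and "\<And>K1 K2. K1 \<in> \<K> \<Longrightarrow> K2 \<in> \<K> \<Longrightarrow> \<exists>K3\<in>\<K>. g K3 \<subseteq> g K1 \<and> g K3 \<subseteq> g K2"
  shows "filtered (g ` \<K>)"
  using assms unfolding filtered_def by fastforce

lemma well_filteredD:
  assumes "well_filtered Y" "openin Y U" "\<K> \<subseteq> KK Y" "filtered \<K>" "\<Inter>\<K> \<subseteq> U"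
  shows "\<exists>K\<in>\<K>. K \<subseteq> U"
  using assms unfolding well_filtered_def by simp

lemma Dc_subset_RD: "Dc X \<subseteq> RD X"
proof
  fix A assume "A \<in> Dc X"
  then obtain D where A: "A = X closure_of D" and "directed_in X D"
    unfolding Dc_def by blast
  then have D: "D \<subseteq> topspace X" "D \<noteq> {}"
    and dir: "\<And>x y. x \<in> D \<Longrightarrow> y \<in> D \<Longrightarrow> \<exists>z\<in>D. spec_le X x z \<and> spec_le X y z"
    unfolding directed_in_def by simp_all
  \<comment> \<open>The singleton \<open>{d}\<close> makes \<open>up d\<close> an instance of the
    set in \<open>upset_in_KK\<close>.\<close>
  define up where "up d = {y. \<exists>x\<in>{d}. spec_le X x y}" for d
  have refl: "d \<in> up d" if "d \<in> D" for d
    using that D by (auto simp: up_def intro: spec_le_refl)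
  have upK: "up d \<in> KK X" if "d \<in> D" for d
    unfolding up_def by (rule upset_in_KK) (use that D in auto)
  have mono: "up z \<subseteq> up x" if "spec_le X x z" "x \<in> D" for x z
  proof
    fix y assume "y \<in> up z"
    then have "spec_le X z y" by (simp add: up_def)
    then show "y \<in> up x"
      using upK[OF that(2)] that(1) by (simp add: up_def KK_def saturated_in_def)
  qed
  have fil: "filtered (up ` D)"
  proof (rule filteredI_image[OF D(2)])
    fix x y assume xy: "x \<in> D" "y \<in> D"
    then obtain z where "z \<in> D" "spec_le X x z" "spec_le X y z" using dir by blast
    then show "\<exists>z\<in>D. up z \<subseteq> up x \<and> up z \<subseteq> up y" using mono xy by meson
  qed
  have DA: "D \<subseteq> A" unfolding A by (rule closure_of_subset[OF D(1)])
  have "A \<in> closed_meeting X (up ` D)"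
    using DA refl by (auto simp: closed_meeting_def A)
  moreover have "B = A" if B: "B \<in> closed_meeting X (up ` D)" "B \<subseteq> A" for B
  proof -
    have cl: "closedin X B" using B unfolding closed_meeting_def by blast
    \<comment> \<open>\<open>B\<close> contains a point above each \<open>d\<close> in
      \<open>D\<close>, and closed sets are lower sets.\<close>
    have "D \<subseteq> B"
    proof
      fix d assume "d \<in> D"
      then obtain y where "y \<in> B" "spec_le X d y"
        using B(1) unfolding closed_meeting_def up_def by auto
      then show "d \<in> B" using closedin_spec_le[OF cl] by simp
    qed
    then have "A \<subseteq> B" unfolding A using cl by (rule closure_of_minimal)
    then show ?thesis using B(2) by simp
  qed
  moreover have "A \<noteq> {}" "closedin X A" using DA D A by auto
  ultimately show "A \<in> RD X"
    using fil upK unfolding RD_def by blast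
qed

text \<open>Minimality is used only inside \<open>X\<close>, so the argument works for test spaces
  on any type.\<close>

lemma RD_subset_WD_via: "RD X \<subseteq> WD_via TYPE('b) X"
proof
  fix A assume "A \<in> RD X"
  then obtain \<K> where A: "closedin X A" and K: "\<K> \<subseteq> KK X" "filtered \<K>"
    and "A \<in> closed_meeting X \<K>"
    and "\<forall>B\<in>closed_meeting X \<K>. B \<subseteq> A \<longrightarrow> B = A"
    unfolding RD_def by blast
  then have meet: "\<And>K. K \<in> \<K> \<Longrightarrow> A \<inter> K \<noteq> {}"
    and min: "\<And>B. B \<in> closed_meeting X \<K> \<Longrightarrow> B \<subseteq> A \<Longrightarrow> B = A"
    by (simp_all add: closed_meeting_def)
  have At: "A \<subseteq> topspace X" using A by (rule closedin_subset)
  have "\<exists>!y. y \<in> topspace Y \<and> Y closure_of (f ` A) = Y closure_of {y}"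
    if Y: "well_filtered Y" and f: "continuous_map X Y f" for Y :: "'b topology" and f
  proof -
    let ?C = "Y closure_of (f ` A)"
    define up where "up K = {y. \<exists>x\<in>f ` (A \<inter> K). spec_le Y x y}" for K
    have fAt: "f ` A \<subseteq> topspace Y"
      using continuous_map_image_subset_topspace[OF f] At by blast
    have upK: "up K \<in> KK Y" if "K \<in> \<K>" for K
      unfolding up_def
    proof (rule upset_in_KK)
      have "compactin X K" using that K unfolding KK_def by blast
      with A have "compactin X (A \<inter> K)" by (rule closed_Int_compactin)
      then show "compactin Y (f ` (A \<inter> K))" using f by (rule image_compactin)
      show "f ` (A \<inter> K) \<noteq> {}" using meet that by blast
    qed
    have fil: "filtered (up ` \<K>)"
    proof (rule filteredI_image)
      show "\<K> \<noteq> {}" using K unfolding filtered_def by blast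
      fix K1 K2 assume "K1 \<in> \<K>" "K2 \<in> \<K>"
      then obtain K3 where "K3 \<in> \<K>" "K3 \<subseteq> K1 \<inter> K2" using K unfolding filtered_def by blast
      then show "\<exists>K3\<in>\<K>. up K3 \<subseteq> up K1 \<and> up K3 \<subseteq> up K2" unfolding up_def by blast
    qed
    have "\<not> \<Inter>(up ` \<K>) \<subseteq> topspace Y - ?C"
    proof
      assume "\<Inter>(up ` \<K>) \<subseteq> topspace Y - ?C"
      moreover have "openin Y (topspace Y - ?C)" by auto
      moreover have "up ` \<K> \<subseteq> KK Y" using upK by blast
      ultimately have "\<exists>P\<in>up ` \<K>. P \<subseteq> topspace Y - ?C"
        using Y fil by (intro well_filteredD)
      then obtain K where K': "K \<in> \<K>" "up K \<subseteq> topspace Y - ?C" by blast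
      then obtain x where x: "x \<in> A" "x \<in> K" using meet by blast
      then have "spec_le Y (f x) (f x)" using fAt by (intro spec_le_refl) blast
      then have "f x \<in> up K" using x unfolding up_def by blast
      moreover have "f x \<in> ?C" using closure_of_subset[OF fAt] x by blast
      ultimately show False using K' by blast
    qed
    then obtain y where y': "y \<notin> topspace Y - ?C" and y: "\<And>K. K \<in> \<K> \<Longrightarrow> y \<in> up K" by blast
    \<comment> \<open>Lying outside \<open>topspace Y - ?C\<close> does not yet put \<open>y\<close>
      in the space; membership in a single \<open>up K0\<close> does.\<close>
    obtain K0 where "K0 \<in> \<K>" using K(2) unfolding filtered_def by blast
    then have "y \<in> up K0" by (rule y)
    then have yt: "y \<in> topspace Y" unfolding up_def spec_le_def by blast
    then have yC: "y \<in> ?C" using y' by blast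
    \<comment> \<open>Any \<open>x\<close> witnessing \<open>y \<in> up K\<close> lies in
      \<open>B \<inter> K\<close>, so minimality of \<open>A\<close> applies to
      \<open>B\<close>.\<close>
    define B where "B = A \<inter> {x \<in> topspace X. f x \<in> Y closure_of {y}}"
    have "closedin X B" unfolding B_def
      by (intro closedin_Int A closedin_continuous_map_preimage[OF f]) auto
    moreover have "B \<inter> K \<noteq> {}" if K': "K \<in> \<K>" for K
    proof -
      obtain x where "x \<in> A \<inter> K" "spec_le Y (f x) y"
        using y[OF K'] unfolding up_def by blast
      then show ?thesis using At unfolding B_def spec_le_def by blast
    qed
    ultimately have "B = A"
      by (intro min) (simp_all add: closed_meeting_def B_def)
    then have "?C \<subseteq> Y closure_of {y}"
      unfolding B_def by (intro closure_of_minimal) auto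
    moreover have "Y closure_of {y} \<subseteq> ?C"
      using yC by (intro closure_of_minimal) auto
    ultimately have "?C = Y closure_of {y}" by blast
    moreover have "t0_space Y" using Y by (simp add: well_filtered_def)
    ultimately show ?thesis
      using yt unfolding t0_space_closure_of_sing by metis
  qed
  then show "A \<in> WD_via TYPE('b) X" using A unfolding WD_via_def by blast
qed

text \<open>A minimal member exists by finiteness, and filteredness makes it the least one.\<close>

lemma Inter_in_finite_filtered:
  assumes "finite \<K>" "filtered \<K>"
  shows "\<Inter>\<K> \<in> \<K>"
proof -
  obtain K where K: "K \<in> \<K>" "\<And>L. L \<in> \<K> \<Longrightarrow> L \<subseteq> K \<Longrightarrow> L = K"
    using finite_has_minimal[of \<K>] assms unfolding filtered_def by metis
  have "K \<subseteq> L" if L: "L \<in> \<K>" for L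
  proof -
    obtain M where "M \<in> \<K>" "M \<subseteq> K \<inter> L"
      using assms(2) K(1) L unfolding filtered_def by blast
    then show ?thesis using K(2)[of M] by blast
  qed
  then have "\<Inter>\<K> = K" using K(1) by blast
  then show ?thesis using K(1) by simp
qed

lemma well_filtered_finite:
  assumes "finite (topspace Y)" "t0_space Y"
  shows "well_filtered Y"
  unfolding well_filtered_def
proof (intro conjI allI impI)
  fix U \<K> assume a: "openin Y U \<and> \<K> \<subseteq> KK Y \<and> filtered \<K> \<and> \<Inter>\<K> \<subseteq> U"
  then have "\<K> \<subseteq> Pow (topspace Y)" unfolding KK_def compactin_def by blast
  then have "finite \<K>" using assms(1) by (meson finite_Pow_iff finite_subset)
  then show "\<exists>K\<in>\<K>. K \<subseteq> U" using Inter_in_finite_filtered a by blast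
qed (rule assms(2))

text \<open>The Alexandrov topology, whose specialization order is \<open>\<le>\<close>. On
  \<open>bool set\<close>, ordered by inclusion, it is the square of the Sierpinski space.\<close>

definition upset_topology :: "'b::order topology" where
  "upset_topology = topology (\<lambda>U. \<forall>x\<in>U. \<forall>y\<ge>x. y \<in> U)"

lemma openin_upset_topology:
  fixes U :: "'b::order set"
  shows "openin upset_topology U \<longleftrightarrow> (\<forall>x\<in>U. \<forall>y\<ge>x. y \<in> U)"
proof -
  have "istopology (\<lambda>U::'b set. \<forall>x\<in>U. \<forall>y\<ge>x. y \<in> U)"
    unfolding istopology_def by blast
  then show ?thesis unfolding upset_topology_def by (simp add: topology_inverse')
qed

lemma topspace_upset_topology [simp]: "topspace upset_topology = UNIV"
  unfolding topspace_def openin_upset_topology by blast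

lemma closure_of_upset_topology:
  "upset_topology closure_of S = {x. \<exists>y\<in>S. x \<le> y}"
proof -
  have "\<exists>y\<in>S. x \<le> y" if x: "x \<in> upset_topology closure_of S" for x
  proof -
    \<comment> \<open>\<open>{x..}\<close> is the least open neighbourhood of
      \<open>x\<close>.\<close>
    have "openin upset_topology {x..}" by (auto simp: openin_upset_topology)
    moreover have "x \<in> {x..}" by simp
    ultimately obtain y where "y \<in> S" "y \<in> {x..}"
      using x unfolding in_closure_of by meson
    then show ?thesis by auto
  qed
  moreover have "x \<in> upset_topology closure_of S" if "y \<in> S" "x \<le> y" for x y
    using that unfolding in_closure_of openin_upset_topology by auto
  ultimately show ?thesis by blast
qed

lemma t0_space_upset_topology: "t0_space upset_topology"
  unfolding t0_space_closure_of_sing closure_of_upset_topology by (auto intro: order_antisym)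

lemma continuous_map_upset_topology_char:
  fixes F :: "'i::finite \<Rightarrow> 'a set"
  assumes "\<And>i. closedin X (F i)"
  shows "continuous_map X upset_topology (\<lambda>x. {i. x \<notin> F i})" (is "continuous_map X _ ?f")
  unfolding continuous_map_def
proof (intro conjI allI impI)
  fix U :: "'i set set" assume U: "openin upset_topology U"
  \<comment> \<open>As \<open>U\<close> is an upper set, \<open>?f x \<in> U\<close> means that
    \<open>?f x\<close> includes some \<open>s \<in> U\<close>. Each \<open>s\<close> is finite, so
    the union of its \<open>F i\<close> is closed.\<close>
  have "{x \<in> topspace X. ?f x \<in> U} = (\<Union>s\<in>U. topspace X - (\<Union>i\<in>s. F i))"
    (is "_ = ?R")
  proof
    show "?R \<subseteq> {x \<in> topspace X. ?f x \<in> U}"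
    proof
      fix x assume "x \<in> ?R"
      then obtain s where "s \<in> U" "x \<in> topspace X" "s \<subseteq> ?f x" by blast
      then show "x \<in> {x \<in> topspace X. ?f x \<in> U}"
        using U unfolding openin_upset_topology by blast
    qed
  qed blast
  moreover have "openin X ?R"
    using assms by (intro openin_Union ballI) (auto intro!: openin_diff closedin_Union)
  ultimately show "openin X {x \<in> topspace X. ?f x \<in> U}" by simp
qed simp

lemma WD_viaD:
  fixes Y :: "'b topology"
  assumes "well_filtered Y" "continuous_map X Y f" "A \<in> WD_via TYPE('b) X"
  shows "\<exists>!y. y \<in> topspace Y \<and> Y closure_of (f ` A) = Y closure_of {y}"
  using assms unfolding WD_via_def by blast

lemma WD_subset_Irrc: "WD X \<subseteq> Irrc X"
proof
  fix A assume A: "A \<in> WD X"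
  then have clA: "closedin X A" unfolding WD_def WD_via_def by blast
  \<comment> \<open>A positive form of irreducibility: every \<open>F i\<close> containing this
    \<open>a\<close> contains all of \<open>A\<close>.\<close>
  have sup_in: "\<exists>a\<in>A. \<forall>b\<in>A. {i. b \<notin> F i} \<subseteq> {i. a \<notin> F i}"
    if "\<And>i. closedin X (F i)" for F :: "bool \<Rightarrow> 'a set"
  proof -
    let ?f = "\<lambda>x. {i. x \<notin> F i}"
    let ?Y = "upset_topology :: bool set topology"
    have "well_filtered ?Y"
      by (intro well_filtered_finite t0_space_upset_topology) simp
    moreover have "continuous_map X ?Y ?f"
      using that by (rule continuous_map_upset_topology_char)
    \<comment> \<open>\<open>WD\<close> tests on \<open>'a set\<close>, which may have fewer than
      the four points of \<open>bool set\<close>; the transfer lemma bridges this.\<close>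
    moreover have "A \<in> WD_via TYPE(bool set) X"
      using A WD_subset_WD_via by blast
    ultimately have "\<exists>!y. y \<in> topspace ?Y \<and> ?Y closure_of (?f ` A) = ?Y closure_of {y}"
      by (intro WD_viaD)
    then obtain y where "?Y closure_of (?f ` A) = ?Y closure_of {y}" by blast
    \<comment> \<open>Taking \<open>z = y\<close> puts \<open>y\<close> below some
      \<open>?f a\<close>; taking \<open>z = ?f b\<close> puts each \<open>?f b\<close> below
      \<open>y\<close>.\<close>
    then have y: "(\<exists>b\<in>A. z \<subseteq> ?f b) \<longleftrightarrow> z \<subseteq> y" for z
      unfolding closure_of_upset_topology set_eq_iff by simp
    then obtain a where "a \<in> A" "y \<subseteq> ?f a" by blast
    moreover have "?f b \<subseteq> y" if "b \<in> A" for b using that y by blast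
    ultimately show ?thesis by blast
  qed
  \<comment> \<open>Only the existence of a witness in \<open>A\<close> matters here, so a constant
    family suffices.\<close>
  have "A \<noteq> {}" using sup_in[of "\<lambda>_. A"] clA by blast
  moreover have "A \<subseteq> F1 \<or> A \<subseteq> F2"
    if F: "closedin X F1" "closedin X F2" "A \<subseteq> F1 \<union> F2" for F1 F2
  proof -
    let ?F = "\<lambda>i. if i then F1 else F2"
    have "closedin X (?F i)" for i using F by simp
    from sup_in[of ?F, OF this] obtain a
      where a: "a \<in> A" "\<forall>b\<in>A. {i. b \<notin> ?F i} \<subseteq> {i. a \<notin> ?F i}" by blast
    have "a \<notin> ?F i" if "b \<in> A" "b \<notin> ?F i" for b i
      using a(2) that by blast
    \<comment> \<open>Since \<open>a\<close> lies in \<open>F1\<close> or \<open>F2\<close>, the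
      contrapositive puts all of \<open>A\<close> in that same set.\<close>
    from this[of _ True] this[of _ False] show ?thesis using a(1) F(3) by (simp add: subset_iff) blast
  qed
  ultimately show "A \<in> Irrc X"
    using clA closedin_subset unfolding Irrc_def irreducible_in_def by blast
qed

theorem proposition6p2:
  fixes X :: "'a topology"
  assumes "t0_space X"
  shows "Dc X \<subseteq> RD X \<and> RD X \<subseteq> WD X \<and> WD X \<subseteq> Irrc X"
  using Dc_subset_RD RD_subset_WD_via WD_subset_Irrc unfolding WD_def by blast

end
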